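(* Let $n,k,d$ be integers with $k\geq d\geq 3$ and $n\geq\frac{dk}{d-1}$, and let $\mathcal{F}\subseteq \binom{[n]}{k}$ be a stable family of $k$-subsets of $[n]$ such that, for all distinct sets $A_1,\ldots,A_d \in\mathcal{F}$, \[ A_1\cap\cdots\cap A_d \neq \emptyset \quad\text{whenever}\quad |A_1\cup \cdots\cup A_d| \leq 2k-(d-2). \] Then \[ |\mathcal{F}| \leq \binom{n-1}{k-1}. \] Furthermore, equality holds if and only if $\mathcal{F}$ is a star.
   Context: $[n]=\{1,\ldots,n\}$ and $\binom{[n]}{k}$ is the family of all $k$-element subsets of $[n]$. A star is a family consisting of all $k$-element subsets of $[n]$ that contain some fixed element of $[n]$. For $i,j\in[n]$, the $(i,j)$-shift of a family $\mathcal{F}\subseteq 2^{[n]}$ is $S_{ij}(\mathcal{F}) = \{S_{ij}(A) : A\in\mathcal{F}\}$, where for $A\in\mathcal{F}$, $S_{ij}(A) = A' := (A\setminus\{j\})\cup\{i\}$ if $j\in A$, $i\notin A$ and $A'\notin\mathcal{F}$, and $S_{ij}(A)=A$ otherwise. The family $\mathcal{F}$ is stable if $S_{ij}(\mathcal{F})=\mathcal{F}$ whenever $1\leq i<j\leq n$. *)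

theory Defs
  imports Complex_Main
begin

definition k_subsets :: "nat \<Rightarrow> nat \<Rightarrow> nat set set" where
  "k_subsets n k = {A. A \<subseteq> {1..n} \<and> card A = k}"

definition is_star :: "nat \<Rightarrow> nat \<Rightarrow> nat set set \<Rightarrow> bool" where
  "is_star n k F \<longleftrightarrow> (\<exists>x\<in>{1..n}. F = {A \<in> k_subsets n k. x \<in> A})"

definition shift_set :: "nat \<Rightarrow> nat \<Rightarrow> nat set set \<Rightarrow> nat set \<Rightarrow> nat set" where
  "shift_set i j F A =
     (let A' = insert i (A - {j})
      in if j \<in> A \<and> i \<notin> A \<and> A' \<notin> F then A' else A)"

definition shift_family :: "nat \<Rightarrow> nat \<Rightarrow> nat set set \<Rightarrow> nat set set" where
  "shift_family i j F = shift_set i j F ` F"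

definition stable_family :: "nat \<Rightarrow> nat set set \<Rightarrow> bool" where
  "stable_family n F \<longleftrightarrow> (\<forall>i j. 1 \<le> i \<and> i < j \<and> j \<le> n \<longrightarrow> shift_family i j F = F)"

end

theory Submission
  imports Defs "HOL-Library.FuncSet"
begin

text \<open>
  A shifted family \<open>F\<close> with at least \<open>(n - 1) choose (k - 1)\<close> members consists of sets containing \<open>1\<close>;
  this single implication covers the bound and the case of equality. Induct on \<open>n\<close> for all
  \<open>d \<le> k + 1\<close>. The family of sets avoiding \<open>n\<close> clearly inherits the hypothesis. So does the link of \<open>n\<close>:
  given \<open>d\<close> of its members with empty intersection, add \<open>n\<close> back to all but one of them and, using
  shiftedness, some other \<open>x\<close> to the last one. Such an \<open>x\<close> exists because otherwise the complements
  of the \<open>d\<close> sets would be pairwise disjoint, which \<open>n \<ge> dk/(d - 1)\<close> forbids.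

  If \<open>d = k + 1\<close>, a set avoiding \<open>1\<close> compresses to all \<open>k\<close>-subsets of \<open>{1..k+1}\<close>. If \<open>n\<close> is
  minimal, the union condition is void and \<open>F\<close> is \<open>d\<close>-wise intersecting. Put \<open>m = n - k\<close>. When
  \<open>n < d m\<close>, pass to the upper shadow of \<open>F\<close> in \<open>{1..n+1}\<close>, which keeps \<open>m\<close> and is large enough by the
  Kruskal-Katona theorem for shifted families. When \<open>n = d m\<close>, let \<open>H\<close> be the \<open>m\<close>-sets whose complement is
  not in \<open>F\<close>: every partition of \<open>{1..n}\<close> into \<open>d\<close> blocks of size \<open>m\<close> has a block in \<open>H\<close>, and
  averaging over all partitions shows that it has exactly one, which forces \<open>H\<close> to contain the star at \<open>1\<close>.
\<close>

section \<open>Shifted families\<close>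

text \<open>Stability as a closure property of single sets, the form that passes easily to links,
  deletions and upper shadows.\<close>

definition shifted :: "nat \<Rightarrow> nat set set \<Rightarrow> bool" where
  "shifted n F \<longleftrightarrow>
     (\<forall>A\<in>F. \<forall>i j. 1 \<le> i \<and> i < j \<and> j \<le> n \<and> j \<in> A \<and> i \<notin> A \<longrightarrow> insert i (A - {j}) \<in> F)"

definition link :: "nat \<Rightarrow> nat set set \<Rightarrow> nat set set" where
  "link x F = {B. x \<notin> B \<and> insert x B \<in> F}"

definition deletion :: "nat \<Rightarrow> nat set set \<Rightarrow> nat set set" where
  "deletion x F = {A \<in> F. x \<notin> A}"

definition upper_shadow :: "nat \<Rightarrow> nat set set \<Rightarrow> nat set set" where
  "upper_shadow n F = {insert x A | x A. A \<in> F \<and> x \<in> {1..n} \<and> x \<notin> A}"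

text \<open>At most \<open>d\<close> sets instead of exactly \<open>d\<close>, so that indexed or
  chosen families with repetitions qualify.\<close>

definition d_wise_intersecting :: "nat \<Rightarrow> nat set set \<Rightarrow> bool" where
  "d_wise_intersecting d F \<longleftrightarrow> (\<forall>S\<subseteq>F. finite S \<and> S \<noteq> {} \<and> card S \<le> d \<longrightarrow> \<Inter>S \<noteq> {})"

text \<open>The bound \<open>2k - (d - 2)\<close> is written additively to avoid truncated
  subtraction; a \<open>d\<close>-element \<open>S\<close> stands for \<open>d\<close> distinct
  sets.\<close>

definition cond_intersecting :: "nat \<Rightarrow> nat \<Rightarrow> nat set set \<Rightarrow> bool" where
  "cond_intersecting d k F \<longleftrightarrow>
     (\<forall>S\<subseteq>F. card S = d \<and> card (\<Union>S) + d \<le> 2 * k + 2 \<longrightarrow> \<Inter>S \<noteq> {})"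

text \<open>For \<open>n = d * m\<close> the disjoint blocks fill \<open>{1..n}\<close>, so these
  are ordered partitions. Extensional functions keep the collection finite.\<close>

definition block_partitions :: "nat \<Rightarrow> nat \<Rightarrow> nat \<Rightarrow> (nat \<Rightarrow> nat set) set" where
  "block_partitions n d m =
     {B \<in> {..<d} \<rightarrow>\<^sub>E k_subsets n m. \<forall>i<d. \<forall>j<d. i \<noteq> j \<longrightarrow> B i \<inter> B j = {}}"

lemma shiftedD:
  assumes "shifted n F" "A \<in> F" "1 \<le> i" "i < j" "j \<le> n" "j \<in> A" "i \<notin> A"
  shows "insert i (A - {j}) \<in> F"
  using assms unfolding shifted_def by blast

lemma stable_imp_shifted:
  assumes "stable_family n F"
  shows "shifted n F"
  unfolding shifted_def
proof (intro ballI allI impI)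
  fix A i j
  assume A: "A \<in> F" and ij: "1 \<le> i \<and> i < j \<and> j \<le> n \<and> j \<in> A \<and> i \<notin> A"
  then have eq: "shift_family i j F = F"
    using assms by (auto simp: stable_family_def)
  show "insert i (A - {j}) \<in> F"
  proof (rule ccontr)
    assume "insert i (A - {j}) \<notin> F"
    then have "shift_set i j F A = insert i (A - {j})"
      using ij by (simp add: shift_set_def)
    then show False
      using A eq \<open>insert i (A - {j}) \<notin> F\<close> unfolding shift_family_def by (metis imageI)
  qed
qed

section \<open>Layers, stars and compression\<close>

lemma finite_k_subsets [simp]: "finite (k_subsets n k)"
  by (rule finite_subset[of _ "Pow {1..n}"]) (auto simp: k_subsets_def)

lemma card_k_subsets: "card (k_subsets n k) = n choose k"
  using n_subsets[of "{1..n}" k] by (simp add: k_subsets_def)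

lemma k_subsetsD:
  assumes "A \<in> k_subsets n k"
  shows "A \<subseteq> {1..n}" "card A = k" "finite A"
  using assms finite_subset[of A "{1..n}"] by (auto simp: k_subsets_def)

lemma card_star:
  assumes "x \<in> {1..n}" "k \<ge> 1"
  shows "card {A \<in> k_subsets n k. x \<in> A} = (n - 1) choose (k - 1)"
proof -
  let ?T = "{B. B \<subseteq> {1..n} - {x} \<and> card B = k - 1}"
  have "bij_betw (insert x) ?T {A \<in> k_subsets n k. x \<in> A}"
  proof (rule bij_betw_byWitness[where f' = "\<lambda>A. A - {x}"])
    show "\<forall>a\<in>?T. insert x a - {x} = a" by auto
    show "\<forall>a'\<in>{A \<in> k_subsets n k. x \<in> A}. insert x (a' - {x}) = a'" by auto
    show "insert x ` ?T \<subseteq> {A \<in> k_subsets n k. x \<in> A}"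
    proof clarify
      fix B assume B: "B \<subseteq> {1..n} - {x}" "card B = k - 1"
      have "finite B" using B(1) by (rule finite_subset) simp
      moreover have "x \<notin> B" using B by auto
      ultimately have "card (insert x B) = k" using B(2) assms(2) by simp
      then show "insert x B \<in> k_subsets n k \<and> x \<in> insert x B"
        using B(1) assms(1) by (auto simp: k_subsets_def)
    qed
    show "(\<lambda>A. A - {x}) ` {A \<in> k_subsets n k. x \<in> A} \<subseteq> ?T"
      by (auto simp: k_subsets_def)
  qed
  then have "card {A \<in> k_subsets n k. x \<in> A} = card ?T"
    by (simp add: bij_betw_same_card)
  also have "\<dots> = (n - 1) choose (k - 1)"
    using n_subsets[of "{1..n} - {x}" "k - 1"] assms(1) by simp
  finally show ?thesis .
qed

lemma k_subsets_exchange: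
  assumes "A \<in> k_subsets n k" "j \<in> A" "i \<notin> A" "i \<in> {1..n}"
  shows "insert i (A - {j}) \<in> k_subsets n k"
proof -
  note A = k_subsetsD[OF assms(1)]
  have "card A \<noteq> 0" using A(3) assms(2) by auto
  then have "card (insert i (A - {j})) = k"
    using A assms by simp
  then show ?thesis using A(1) assms(4) by (auto simp: k_subsets_def)
qed

text \<open>Induct on \<open>card (A - B)\<close>: the least \<open>y\<close> of
  \<open>A - B\<close> is replaced by a smaller element of \<open>B - A\<close>, and the comparison
  of initial segments survives.\<close>

lemma shifted_compress:
  assumes "shifted n F" "F \<subseteq> k_subsets n k" "A \<in> F" "B \<in> k_subsets n k"
    and "\<And>j. card (A \<inter> {1..j}) \<le> card (B \<inter> {1..j})"
  shows "B \<in> F"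
  using assms(3,5)
proof (induction "card (A - B)" arbitrary: A rule: less_induct)
  case less
  note B = k_subsetsD[OF assms(4)]
  have A: "A \<subseteq> {1..n}" "card A = k" "finite A"
    using less.prems(1) assms(2) k_subsetsD by blast+
  show ?case
  proof (cases "A = B")
    case True
    then show ?thesis using less.prems by simp
  next
    case False
    have "A - B \<noteq> {}" using False A B card_subset_eq[of B A] by auto
    define y where "y = Min (A - B)"
    have y: "y \<in> A" "y \<notin> B"
      using Min_in[of "A - B"] \<open>A - B \<noteq> {}\<close> A(3) unfolding y_def by auto
    have ymin: "z \<in> B" if "z \<in> A" "z < y" for z
      using Min_le[of "A - B" z] A(3) that unfolding y_def by fastforce
    have y1: "1 \<le> y" "y \<le> n" using y A by auto
    \<comment> \<open>Otherwise \<open>B\<close> would have strictly fewer elements than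
      \<open>A\<close> in \<open>{1..y}\<close>.\<close>
    have "\<exists>i. i \<in> B \<and> i \<notin> A \<and> i < y"
    proof (rule ccontr)
      assume "\<not> ?thesis"
      then have "B \<inter> {1..y} \<subset> A \<inter> {1..y}" 
        using y y1 by (auto simp: order_le_less)
      then have "card (B \<inter> {1..y}) < card (A \<inter> {1..y})"
        by (intro psubset_card_mono) auto
      then show False using less.prems(2)[of y] by simp
    qed
    then obtain i where i: "i \<in> B" "i \<notin> A" "i < y" by blast
    have i1: "1 \<le> i" using i B by auto
    let ?A = "insert i (A - {y})"
    have AF: "?A \<in> F"
      using shiftedD[OF assms(1) less.prems(1)] i i1 y y1 by blast
    have less_card: "card (?A - B) < card (A - B)"
    proof (rule psubset_card_mono)
      show "finite (A - B)" using A by simp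
      show "?A - B \<subset> A - B" using i y by auto
    qed
    \<comment> \<open>Below \<open>y\<close> the new set lies inside \<open>B\<close> by minimality
      of \<open>y\<close>; from \<open>y\<close> on its counts agree with those of
      \<open>A\<close>.\<close>
    have "card (?A \<inter> {1..j}) \<le> card (B \<inter> {1..j})" for j
    proof (cases "j < y")
      case True
      then have "?A \<inter> {1..j} \<subseteq> B \<inter> {1..j}" using ymin i by auto
      then show ?thesis by (intro card_mono) auto
    next
      case False
      then have "?A \<inter> {1..j} = insert i (A \<inter> {1..j} - {y})" using i i1 by auto
      moreover have "card (insert i (A \<inter> {1..j} - {y})) = card (A \<inter> {1..j})"
        using False y(1) y1 i(2) card.remove[of "A \<inter> {1..j}" y] by simp
      ultimately show ?thesis using less.prems(2)[of j] by simp
    qed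
    then show ?thesis using less.hyps[OF less_card AF] by blast
  qed
qed

section \<open>Links and upper shadows\<close>

lemma deletion_k_subsets:
  assumes "F \<subseteq> k_subsets (Suc n) k"
  shows "deletion (Suc n) F \<subseteq> k_subsets n k"
proof
  fix A assume "A \<in> deletion (Suc n) F"
  then have "A \<in> k_subsets (Suc n) k" "Suc n \<notin> A" using assms by (auto simp: deletion_def)
  then show "A \<in> k_subsets n k"
    by (fastforce simp: k_subsets_def le_Suc_eq)
qed

lemma link_k_subsets:
  assumes "F \<subseteq> k_subsets (Suc n) (Suc k)"
  shows "link (Suc n) F \<subseteq> k_subsets n k"
proof
  fix B assume "B \<in> link (Suc n) F"
  then have B: "insert (Suc n) B \<in> k_subsets (Suc n) (Suc k)" "Suc n \<notin> B"
    using assms by (auto simp: link_def)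
  have "finite B" using k_subsetsD(3)[OF B(1)] by simp
  then have "card B = k" using k_subsetsD(2)[OF B(1)] B(2) by simp
  moreover have "B \<subseteq> {1..n}"
  proof
    fix b assume b: "b \<in> B"
    then have "b \<in> {1..Suc n}" "b \<noteq> Suc n" using k_subsetsD(1)[OF B(1)] B(2) by auto
    then show "b \<in> {1..n}" by auto
  qed
  ultimately show "B \<in> k_subsets n k" by (simp add: k_subsets_def)
qed

lemma shifted_deletion: "shifted (Suc n) F \<Longrightarrow> shifted n (deletion (Suc n) F)"
  unfolding shifted_def deletion_def by auto

lemma shifted_link: 
  assumes "shifted (Suc n) F"
  shows "shifted n (link (Suc n) F)"
  unfolding shifted_def
proof (intro ballI allI impI)
  fix A i j
  assume A: "A \<in> link (Suc n) F" and ij: "1 \<le> i \<and> i < j \<and> j \<le> n \<and> j \<in> A \<and> i \<notin> A"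
  then have "insert i (insert (Suc n) A - {j}) \<in> F"
    by (intro shiftedD[OF assms]) (auto simp: link_def)
  moreover have "insert i (insert (Suc n) A - {j}) = insert (Suc n) (insert i (A - {j}))"
    using ij by auto
  ultimately show "insert i (A - {j}) \<in> link (Suc n) F"
    using A ij by (auto simp: link_def)
qed

lemma card_link_deletion:
  assumes "finite F"
  shows "card F = card (link x F) + card (deletion x F)"
proof -
  have "F = insert x ` link x F \<union> deletion x F"
  proof
    show "F \<subseteq> insert x ` link x F \<union> deletion x F"
    proof
      fix A assume A: "A \<in> F"
      show "A \<in> insert x ` link x F \<union> deletion x F"
      proof (cases "x \<in> A")
        case True
        then have "A - {x} \<in> link x F" "A = insert x (A - {x})"
          using A by (auto simp: link_def insert_absorb)
        then show ?thesis by blast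
      qed (use A in \<open>auto simp: deletion_def\<close>)
    qed
  qed (auto simp: link_def deletion_def)
  moreover have "inj_on (insert x) (link x F)" 
    by (auto simp: inj_on_def link_def)
  moreover have "insert x ` link x F \<inter> deletion x F = {}"
    by (auto simp: deletion_def)
  ultimately show ?thesis
    using assms by (metis card_Un_disjoint card_image finite_Un)
qed

text \<open>Shifting \<open>Suc n\<close> to \<open>x\<close> turns \<open>insert (Suc n) B\<close>
  into \<open>insert x B\<close>.\<close>

lemma upper_shadow_link_subset:
  assumes "shifted (Suc n) F"
  shows "upper_shadow n (link (Suc n) F) \<subseteq> deletion (Suc n) F"
proof
  fix A assume "A \<in> upper_shadow n (link (Suc n) F)"
  then obtain x B where A: "A = insert x B" and B: "B \<in> link (Suc n) F"
    and x: "x \<in> {1..n}" "x \<notin> B"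
    by (auto simp: upper_shadow_def)
  then have "insert x (insert (Suc n) B - {Suc n}) \<in> F"
    by (intro shiftedD[OF assms]) (auto simp: link_def)
  then show "A \<in> deletion (Suc n) F"
    using A B x by (auto simp: link_def deletion_def)
qed

lemma upper_shadow_k_subsets:
  assumes "F \<subseteq> k_subsets n k" "n \<le> N"
  shows "upper_shadow N F \<subseteq> k_subsets N (Suc k)"
proof
  fix A assume "A \<in> upper_shadow N F"
  then obtain x B where A: "A = insert x B" and B: "B \<in> F" and x: "x \<in> {1..N}" "x \<notin> B"
    by (auto simp: upper_shadow_def)
  have "B \<in> k_subsets n k" using assms B by auto
  note B' = k_subsetsD[OF this]
  show "A \<in> k_subsets N (Suc k)"
    using B' x assms(2) unfolding A k_subsets_def by fastforce
qed

text \<open>The new point \<open>Suc n\<close> can be added to every member of \<open>F\<close>,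
  giving \<open>card F\<close> sets outside the old shadow.\<close>

lemma card_upper_shadow_ge:
  assumes "F \<subseteq> k_subsets n k"
  shows "card (upper_shadow (Suc n) F) \<ge> card (upper_shadow n F) + card F"
proof -
  have fin: "finite F" using assms finite_k_subsets finite_subset by blast
  have out: "Suc n \<notin> A" if "A \<in> F" for A
    using k_subsetsD(1)[of A n k] that assms by fastforce
  have "inj_on (insert (Suc n)) F"
    using out unfolding inj_on_def by (metis insert_ident)
  moreover have "Suc n \<notin> A" if "A \<in> upper_shadow n F" for A
    using that out by (auto simp: upper_shadow_def)
  then have "upper_shadow n F \<inter> insert (Suc n) ` F = {}" by blast
  moreover have f1: "finite (upper_shadow n F)" "finite (upper_shadow (Suc n) F)"
    using upper_shadow_k_subsets[OF assms, of n] upper_shadow_k_subsets[OF assms, of "Suc n"]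
      finite_k_subsets finite_subset by (metis order_refl le_SucI)+
  ultimately have "card (upper_shadow n F) + card F = card (upper_shadow n F \<union> insert (Suc n) ` F)"
    using fin by (simp add: card_Un_disjoint card_image)
  also have "\<dots> \<le> card (upper_shadow (Suc n) F)"
  proof (rule card_mono[OF f1(2)])
    have "insert (Suc n) A \<in> upper_shadow (Suc n) F" if "A \<in> F" for A
      using that out[OF that] unfolding upper_shadow_def by fastforce
    then show "upper_shadow n F \<union> insert (Suc n) ` F \<subseteq> upper_shadow (Suc n) F"
      by (fastforce simp: upper_shadow_def)
  qed
  finally show ?thesis .
qed

lemma upper_shadow_mono: "F \<subseteq> G \<Longrightarrow> upper_shadow n F \<subseteq> upper_shadow n G"
  by (auto simp: upper_shadow_def)

text \<open>Pascal's rule on both sides: if the deletion is too small for the induction, then the upper shadow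
  of the link, which lies in the deletion by shiftedness, makes it large after all.\<close>

lemma card_upper_shadow_shifted:
  assumes "shifted (Suc n) F" "F \<subseteq> k_subsets (Suc n) (Suc k)" "n choose k \<le> card F"
  shows "n choose Suc k \<le> card (upper_shadow (Suc n) F)"
  using assms
proof (induction n arbitrary: k F)
  case 0
  then show ?case by simp
next
  case (Suc n)
  let ?N = "Suc (Suc n)"
  let ?D = "deletion ?N F" and ?L = "link ?N F"
  have fin: "finite F" "finite (upper_shadow ?N F)"
    using Suc.prems(2) upper_shadow_k_subsets[OF Suc.prems(2) order_refl] 
      finite_k_subsets finite_subset by metis+
  have D: "?D \<subseteq> k_subsets (Suc n) (Suc k)" by (rule deletion_k_subsets[OF Suc.prems(2)])
  have cDL: "card F = card ?L + card ?D" by (rule card_link_deletion[OF fin(1)])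
  have DF: "?D \<subseteq> F" by (auto simp: deletion_def)
  show ?case
  proof (cases "n choose k \<le> card ?D")
    case True
    have "n choose Suc k \<le> card (upper_shadow (Suc n) ?D)"
      by (rule Suc.IH[OF shifted_deletion[OF Suc.prems(1)] D True])
    then have "Suc n choose Suc k \<le> card (upper_shadow (Suc n) ?D) + card ?D"
      using True by simp
    also have "\<dots> \<le> card (upper_shadow ?N ?D)"
      by (rule card_upper_shadow_ge[OF D])
    also have "\<dots> \<le> card (upper_shadow ?N F)"
      by (rule card_mono[OF fin(2) upper_shadow_mono[OF DF]])
    finally show ?thesis .
  next
    case False
    have finD: "finite ?D" using fin DF finite_subset by blast
    have sub: "upper_shadow (Suc n) ?L \<subseteq> ?D" by (rule upper_shadow_link_subset[OF Suc.prems(1)])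
    show ?thesis
    proof (cases k)
      \<comment> \<open>Here the induction hypothesis does not apply to the link. But the link
        contains the empty set, so its shadow contains \<open>{1}\<close>, while the deletion is
        empty.\<close>
      case 0
      have "card ?D = 0" using False 0 by simp
      then have D0: "?D = {}" using finD by simp
      have "card ?L \<noteq> 0" using cDL Suc.prems(3) 0 \<open>card ?D = 0\<close> by simp
      then obtain B where B: "B \<in> ?L" by (metis card.empty ex_in_conv)
      then have "B \<in> k_subsets (Suc n) 0" using link_k_subsets[OF Suc.prems(2)] 0 by auto
      then have "B = {}" using k_subsetsD by fastforce
      then have "{1} \<in> upper_shadow (Suc n) ?L" using B unfolding upper_shadow_def by fastforce
      then show ?thesis using sub D0 by auto
    next
      case (Suc k')
      have L: "?L \<subseteq> k_subsets (Suc n) (Suc k')"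
        using link_k_subsets[OF Suc.prems(2)] Suc by simp
      have "n choose k' \<le> card ?L" using False cDL Suc.prems(3) Suc by simp
      then have "n choose Suc k' \<le> card (upper_shadow (Suc n) ?L)"
        by (rule Suc.IH[OF shifted_link[OF Suc.prems(1)] L])
      also have "\<dots> \<le> card ?D" by (rule card_mono[OF finD sub])
      finally show ?thesis using False Suc by simp
    qed
  qed
qed

text \<open>If \<open>j\<close> is the added point, add \<open>i\<close> instead; otherwise
  \<open>j\<close> lies in the underlying member of \<open>F\<close>, which can itself be
  shifted.\<close>

lemma shifted_upper_shadow:
  assumes "shifted n F" "F \<subseteq> k_subsets n k"
  shows "shifted (Suc n) (upper_shadow (Suc n) F)"
  unfolding shifted_def
proof (intro ballI allI impI)
  fix A i j
  assume "A \<in> upper_shadow (Suc n) F" 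
    and ij: "1 \<le> i \<and> i < j \<and> j \<le> Suc n \<and> j \<in> A \<and> i \<notin> A"
  then obtain x B where A: "A = insert x B" and B: "B \<in> F" and x: "x \<in> {1..Suc n}" "x \<notin> B"
    by (auto simp: upper_shadow_def)
  show "insert i (A - {j}) \<in> upper_shadow (Suc n) F"
  proof (cases "j = x")
    case True
    then have "insert i (A - {j}) = insert i B" using A x by auto
    then show ?thesis using B ij A unfolding upper_shadow_def by fastforce
  next
    case False
    have "j \<in> B" using False ij A by auto
    then have "j \<le> n" using B assms(2) k_subsetsD(1)[of B n k] by fastforce
    then have "insert i (B - {j}) \<in> F" using shiftedD[OF assms(1) B] ij A \<open>j \<in> B\<close> by auto
    moreover have "insert i (A - {j}) = insert x (insert i (B - {j}))" using A False by auto
    moreover have "x \<notin> insert i (B - {j})" using ij A x by auto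
    ultimately show ?thesis using x unfolding upper_shadow_def by blast
  qed
qed

text \<open>Choose inside each set a member of \<open>F\<close>; the chosen sets already have a
  common point.\<close>

lemma d_wise_upper_shadow:
  assumes "d_wise_intersecting d F"
  shows "d_wise_intersecting d (upper_shadow n F)"
  unfolding d_wise_intersecting_def
proof (intro allI impI)
  fix S assume S: "S \<subseteq> upper_shadow n F" "finite S \<and> S \<noteq> {} \<and> card S \<le> d"
  have "\<forall>A\<in>S. \<exists>B\<in>F. B \<subseteq> A" using S(1) by (fastforce simp: upper_shadow_def)
  then obtain g where g: "\<And>A. A \<in> S \<Longrightarrow> g A \<in> F \<and> g A \<subseteq> A" by metis
  have "card (g ` S) \<le> d" using S(2) card_image_le[of S g] by simp
  moreover have "g ` S \<subseteq> F" "finite (g ` S)" "g ` S \<noteq> {}" using g S by auto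
  ultimately have "\<Inter>(g ` S) \<noteq> {}" using assms unfolding d_wise_intersecting_def by blast
  then show "\<Inter>S \<noteq> {}" using g by blast
qed

section \<open>Partitions into blocks of equal size\<close>

text \<open>Greedy choice: \<open>d\<close> blocks occupy at most \<open>d * m\<close> points, which
  leaves room for another one.\<close>

lemma disjoint_blocks_extend:
  assumes "X \<in> k_subsets n m" "Y \<in> k_subsets n m" "X \<inter> Y = {}" "2 \<le> d" "d * m \<le> n"
  shows "\<exists>B. B 0 = X \<and> B 1 = Y \<and> (\<forall>i<d. B i \<in> k_subsets n m) \<and>
    (\<forall>i<d. \<forall>j<d. i \<noteq> j \<longrightarrow> B i \<inter> B j = {})"
  using assms(4,5)
proof (induction d rule: nat_induct_at_least)
  case base
  show ?case
    by (rule exI[of _ "\<lambda>i. if i = 0 then X else Y"])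
      (use assms(1-3) in \<open>auto simp: less_2_cases_iff\<close>)
next
  case (Suc d)
  have "d * m \<le> n" using Suc.prems by simp
  then obtain B where B: "B 0 = X" "B 1 = Y" "\<And>i. i < d \<Longrightarrow> B i \<in> k_subsets n m"
    "\<And>i j. i < d \<Longrightarrow> j < d \<Longrightarrow> i \<noteq> j \<Longrightarrow> B i \<inter> B j = {}"
    using Suc.IH by blast
  let ?U = "\<Union>i<d. B i"
  have "card ?U \<le> (\<Sum>i<d. card (B i))" by (rule card_UN_le) simp
  also have "\<dots> = (\<Sum>i<d. m)" by (rule sum.cong) (use B(3) k_subsetsD(2) in auto)
  also have "\<dots> = d * m" by simp
  finally have "card ?U \<le> d * m" .
  moreover have "?U \<subseteq> {1..n}" using B(3) k_subsetsD(1) by blast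
  then have "card ({1..n} - ?U) = n - card ?U"
    by (subst card_Diff_subset) (auto intro: finite_subset)
  ultimately have "m \<le> card ({1..n} - ?U)" using Suc.prems by simp
  then obtain Z where Z: "Z \<subseteq> {1..n} - ?U" "card Z = m"
    by (rule obtain_subset_with_card_n)
  show ?case
  proof (rule exI[of _ "B(d := Z)"], intro conjI allI impI)
    show "(B(d := Z)) 0 = X" "(B(d := Z)) 1 = Y" using B(1,2) Suc.hyps by auto
    show "(B(d := Z)) i \<in> k_subsets n m" if "i < Suc d" for i
      using that B(3) Z by (auto simp: k_subsets_def less_Suc_eq)
    show "(B(d := Z)) i \<inter> (B(d := Z)) j = {}" if "i < Suc d" "j < Suc d" "i \<noteq> j" for i j
      using that B(4)[of i j] Z(1) by (auto simp: less_Suc_eq)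
  qed
qed

lemma block_partition_exists:
  assumes "X \<in> k_subsets n m" "Y \<in> k_subsets n m" "X \<inter> Y = {}" "2 \<le> d" "d * m \<le> n"
  obtains B where "B \<in> block_partitions n d m" "B 0 = X" "B 1 = Y"
proof -
  obtain B where "B 0 = X" "B 1 = Y" "\<forall>i<d. B i \<in> k_subsets n m"
    "\<forall>i<d. \<forall>j<d. i \<noteq> j \<longrightarrow> B i \<inter> B j = {}"
    using disjoint_blocks_extend[OF assms] by blast
  then show ?thesis
    using assms(4) by (intro that[of "restrict B {..<d}"]) (auto simp: block_partitions_def)
qed

lemma finite_block_partitions: "finite (block_partitions n d m)"
  unfolding block_partitions_def
  by (rule finite_subset[OF _ finite_PiE[of "{..<d}" "\<lambda>_. k_subsets n m"]]) auto

section \<open>Symmetry and averaging over partitions\<close>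

lemma bij_betw_k_subsets:
  assumes "X \<in> k_subsets n m" "Y \<in> k_subsets n m"
  obtains h where "bij_betw h {1..n} {1..n}" "h ` X = Y"
proof -
  note X = k_subsetsD[OF assms(1)] and Y = k_subsetsD[OF assms(2)]
  obtain f where f: "bij_betw f X Y"
    using finite_same_card_bij[of X Y] X Y by auto
  have "card ({1..n} - X) = card ({1..n} - Y)"
    using X Y by (simp add: card_Diff_subset)
  then obtain g where g: "bij_betw g ({1..n} - X) ({1..n} - Y)"
    using finite_same_card_bij[of "{1..n} - X" "{1..n} - Y"] by auto
  let ?h = "\<lambda>x. if x \<in> X then f x else g x"
  have "bij_betw ?h (X \<union> ({1..n} - X)) (Y \<union> ({1..n} - Y))"
    by (rule bij_betw_disjoint_Un[OF f g]) auto
  moreover have "X \<union> ({1..n} - X) = {1..n}" "Y \<union> ({1..n} - Y) = {1..n}"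
    using X Y by auto
  moreover have "?h ` X = Y" using f by (auto simp: bij_betw_def)
  ultimately show ?thesis using that[of ?h] by metis
qed

text \<open>A permutation carrying \<open>X\<close> to \<open>Y\<close> acts injectively on
  partitions. Exchanging \<open>X\<close> and \<open>Y\<close> gives equality.\<close>

lemma card_block_partitions_fiber_le:
  assumes "X \<in> k_subsets n m" "Y \<in> k_subsets n m" "i < d"
  shows "card {B \<in> block_partitions n d m. B i = X} \<le> card {B \<in> block_partitions n d m. B i = Y}"
proof -
  obtain h where h: "bij_betw h {1..n} {1..n}" "h ` X = Y"
    using bij_betw_k_subsets[OF assms(1,2)] by blast
  have inj: "inj_on h {1..n}" using h(1) by (simp add: bij_betw_def)
  let ?f = "\<lambda>B. \<lambda>l\<in>{..<d}. h ` B l"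
  have sub: "B l \<in> k_subsets n m" if "B \<in> block_partitions n d m" "l < d" for B l
    using that by (auto simp: block_partitions_def)
  show ?thesis
  proof (rule card_inj_on_le[of ?f])
    show "inj_on ?f {B \<in> block_partitions n d m. B i = X}"
    proof (rule inj_onI)
      fix B C
      assume B: "B \<in> {B \<in> block_partitions n d m. B i = X}"
        and C: "C \<in> {B \<in> block_partitions n d m. B i = X}" and eq: "?f B = ?f C"
      show "B = C"
      proof (rule PiE_ext[of _ "{..<d}" "\<lambda>_. k_subsets n m"])
        show "B \<in> {..<d} \<rightarrow>\<^sub>E k_subsets n m" "C \<in> {..<d} \<rightarrow>\<^sub>E k_subsets n m"
          using B C by (auto simp: block_partitions_def)
        fix l assume l: "l \<in> {..<d}"
        then have "h ` B l = h ` C l" using fun_cong[OF eq, of l] by simp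
        moreover have "B l \<subseteq> {1..n}" "C l \<subseteq> {1..n}" 
          using B C l sub k_subsetsD(1) by blast+
        ultimately show "B l = C l" using inj by (simp add: inj_on_image_eq_iff)
      qed
    qed
    show "?f ` {B \<in> block_partitions n d m. B i = X} \<subseteq> {B \<in> block_partitions n d m. B i = Y}"
    proof (rule image_subsetI)
      fix B assume "B \<in> {B \<in> block_partitions n d m. B i = X}"
      then have B: "B \<in> block_partitions n d m" "B i = X" by auto
      have "h ` B l \<in> k_subsets n m" if "l < d" for l
      proof -
        note Bl = k_subsetsD[OF sub[OF B(1) that]]
        have "inj_on h (B l)" using inj Bl(1) by (rule inj_on_subset)
        then show ?thesis
          using Bl h(1) by (auto simp: k_subsets_def card_image bij_betw_def)
      qed
      moreover have "h ` B l \<inter> h ` B j = {}" if "l < d" "j < d" "l \<noteq> j" for l j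
      proof -
        have "B l \<subseteq> {1..n}" "B j \<subseteq> {1..n}" using sub[OF B(1)] k_subsetsD(1) that by blast+
        then have "h ` B l \<inter> h ` B j = h ` (B l \<inter> B j)" 
          using inj by (simp add: inj_on_image_Int)
        then show ?thesis using B(1) that by (simp add: block_partitions_def)
      qed
      ultimately show "?f B \<in> {B \<in> block_partitions n d m. B i = Y}"
        using B h(2) assms(3) by (auto simp: block_partitions_def)
    qed
    show "finite {B \<in> block_partitions n d m. B i = Y}"
      by (simp add: finite_block_partitions)
  qed
qed

text \<open>By symmetry, the \<open>i\<close>-th block lies in \<open>H\<close> for a fraction
  \<open>card H / (n choose m)\<close> of all partitions. So the average number of blocks in
  \<open>H\<close> is at most 1, while each partition has at least one.\<close>

lemma block_partitions_exactly_one: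
  assumes H: "H \<subseteq> k_subsets n m" and le: "d * card H \<le> n choose m" and "m \<le> n"
    and ex: "\<And>B. B \<in> block_partitions n d m \<Longrightarrow> \<exists>i<d. B i \<in> H"
    and B: "B \<in> block_partitions n d m"
  shows "card {i. i < d \<and> B i \<in> H} = 1"
proof -
  let ?P = "block_partitions n d m" and ?C = "n choose m"
  let ?h = "\<lambda>B. card {i. i < d \<and> B i \<in> H}"
  have finH: "finite H" using H by (rule finite_subset) simp
  have h1: "1 \<le> ?h B" if "B \<in> ?P" for B
    using ex[OF that] by (auto simp: Suc_le_eq card_gt_0_iff)
  have fiber: "card {B \<in> ?P. B i \<in> H} * ?C = card H * card ?P" if i: "i < d" for i
  proof -
    have "{1..m} \<in> k_subsets n m" using \<open>m \<le> n\<close> by (auto simp: k_subsets_def)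
    then have fib: "card {B \<in> ?P. B i = X} = card {B \<in> ?P. B i = {1..m}}"
      if "X \<in> k_subsets n m" for X
      using card_block_partitions_fiber_le[OF _ _ i] that by (meson antisym)
    have sum: "card {B \<in> ?P. B i \<in> K} = card K * card {B \<in> ?P. B i = {1..m}}"
      if K: "K \<subseteq> k_subsets n m" for K
    proof -
      have "finite K" using K by (rule finite_subset) simp
      have "{B \<in> ?P. B i \<in> K} = (\<Union>X\<in>K. {B \<in> ?P. B i = X})" by auto
      also have "card \<dots> = (\<Sum>X\<in>K. card {B \<in> ?P. B i = X})"
        by (rule card_UN_disjoint) (use \<open>finite K\<close> finite_block_partitions in auto)
      also have "\<dots> = (\<Sum>X\<in>K. card {B \<in> ?P. B i = {1..m}})"
        by (rule sum.cong) (use fib K in auto)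
      finally show ?thesis by simp
    qed
    \<comment> \<open>Taking all \<open>m\<close>-sets for \<open>K\<close> determines the common
      fiber size, here measured at the reference set \<open>{1..m}\<close>.\<close>
    have "{B \<in> ?P. B i \<in> k_subsets n m} = ?P" using i by (auto simp: block_partitions_def)
    then have "card ?P = ?C * card {B \<in> ?P. B i = {1..m}}"
      using sum[of "k_subsets n m"] card_k_subsets by simp
    then show ?thesis using sum[OF H] by simp
  qed
  have "(\<Sum>B\<in>?P. ?h B) = (\<Sum>i<d. card {B \<in> ?P. B i \<in> H})"
    using sum_multicount_gen[of ?P "{..<d}" "\<lambda>B i. B i \<in> H" "\<lambda>i. card {B \<in> ?P. B i \<in> H}"]
      finite_block_partitions by (simp add: lessThan_def conj_commute)
  then have "(\<Sum>B\<in>?P. ?h B) * ?C = d * card H * card ?P"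
    using fiber by (simp add: sum_distrib_right)
  also have "\<dots> \<le> ?C * card ?P" using le by (rule mult_le_mono1)
  finally have "(\<Sum>B\<in>?P. ?h B) \<le> card ?P" using \<open>m \<le> n\<close> by simp
  show ?thesis
  proof (rule ccontr)
    assume "?h B \<noteq> 1"
    then have "1 < ?h B" using h1[OF B] by linarith
    then have "(\<Sum>B\<in>?P. 1) < (\<Sum>B\<in>?P. ?h B)"
      using B h1 finite_block_partitions by (intro sum_strict_mono_ex1) auto
    then show False using \<open>(\<Sum>B\<in>?P. ?h B) \<le> card ?P\<close> by simp
  qed
qed

text \<open>\<open>H\<close> is intersecting, since two disjoint members would be blocks of one
  partition. Starting from \<open>{1..m}\<close>, induct on the sum of the elements of
  \<open>X\<close>: a missing \<open>X\<close> would produce two disjoint members.\<close>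

lemma exactly_one_block_imp_star:
  assumes H: "H \<subseteq> k_subsets n m" and sh: "shifted n H" and n: "n = d * m" and "m \<ge> 1" "d \<ge> 3"
    and one: "\<And>B. B \<in> block_partitions n d m \<Longrightarrow> card {i. i < d \<and> B i \<in> H} = 1"
    and X: "X \<in> k_subsets n m" "1 \<in> X"
  shows "X \<in> H"
proof -
  have n3: "3 * m \<le> n" using \<open>d \<ge> 3\<close> n by simp
  have unique: "i = j" if "B \<in> block_partitions n d m" "i < d" "j < d" "B i \<in> H" "B j \<in> H" for B i j
  proof -
    have "card {i. i < d \<and> B i \<in> H} = 1" by (rule one[OF that(1)])
    then obtain l where "{i. i < d \<and> B i \<in> H} = {l}" by (rule card_1_singletonE)
    then show ?thesis using that by (metis (mono_tags, lifting) mem_Collect_eq singletonD)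
  qed
  have exH: "\<exists>i<d. B i \<in> H" if "B \<in> block_partitions n d m" for B
    using one[OF that] by (metis (mono_tags, lifting) card.empty empty_Collect_eq zero_neq_one)
  have part: "\<exists>B \<in> block_partitions n d m. B 0 = U \<and> B 1 = V"
    if "U \<in> k_subsets n m" "V \<in> k_subsets n m" "U \<inter> V = {}" for U V
    using block_partition_exists[of U n m V d] that n \<open>d \<ge> 3\<close> by auto
  have inter: "U \<inter> V \<noteq> {}" if UV: "U \<in> H" "V \<in> H" for U V
  proof
    assume "U \<inter> V = {}"
    then obtain B where "B \<in> block_partitions n d m" "B 0 = U" "B 1 = V"
      using part[of U V] UV H by blast
    then show False using unique[of B 0 1] UV \<open>d \<ge> 3\<close> by simp
  qed
  have init_k: "{1..m} \<in> k_subsets n m" "{m+1..2*m} \<in> k_subsets n m"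
    using n3 by (auto simp: k_subsets_def)
  obtain D where D: "D \<in> H"
    using part[OF init_k] exH by fastforce
  have init: "{1..m} \<in> H"
  proof (rule shifted_compress[OF sh H D init_k(1)])
    fix j
    have "card (D \<inter> {1..j}) \<le> m"
      using k_subsetsD[of D n m] D H by (metis card_mono inf_le1 subsetD)
    moreover have "card (D \<inter> {1..j}) \<le> j" 
      using card_mono[of "{1..j}" "D \<inter> {1..j}"] by simp
    ultimately have "card (D \<inter> {1..j}) \<le> card {1..min m j}" by simp
    also have "{1..min m j} = {1..m} \<inter> {1..j}" by auto
    finally show "card (D \<inter> {1..j}) \<le> card ({1..m} \<inter> {1..j})" .
  qed
  show ?thesis
    using X
  proof (induction "\<Sum>X" arbitrary: X rule: less_induct)
    case less
    note X = k_subsetsD[OF less.prems(1)]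
    show ?case
    proof (rule ccontr)
      assume XH: "X \<notin> H"
      then have "X \<noteq> {1..m}" using init by blast
      then have "\<not> X \<subseteq> {1..m}" "\<not> {1..m} \<subseteq> X"
        using X card_subset_eq[of "{1..m}" X] card_subset_eq[of X "{1..m}"] by auto
      then obtain x y where x: "1 \<le> x" "x \<le> m" "x \<notin> X" and y: "y \<in> X" "\<not> (1 \<le> y \<and> y \<le> m)"
        by (meson atLeastAtMost_iff subsetI)
      have xy: "x < y" "1 < x" "y \<in> {1..n}" "x \<in> {1..n}"
        using x y X less.prems(2) by (auto intro: le_neq_trans)
      let ?X = "insert x (X - {y})"
      have X'k: "?X \<in> k_subsets n m"
        using k_subsets_exchange[OF less.prems(1) y(1) x(3)] xy by blast
      have "\<Sum>?X + y = \<Sum>X + x"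
        using x(3) y(1) X(3) sum.remove[of X y "\<lambda>x. x"] by simp
      then have "\<Sum>?X < \<Sum>X" using xy by linarith
      then have X'H: "?X \<in> H" using less.hyps[OF _ X'k] less.prems(2) xy by auto
      \<comment> \<open>Exchanging \<open>x\<close> and \<open>y\<close> in a partition with block \<open>X\<close> moves the block of \<open>H\<close> to the first place.\<close>
      have E: "E \<in> H" if E: "E \<in> k_subsets n m" "x \<in> E" "E \<inter> X = {}" for E
      proof -
        obtain B where B: "B \<in> block_partitions n d m" "B 0 = X" "B 1 = E"
          using part[of X E] E less.prems(1) by blast
        obtain i where i: "i < d" "B i \<in> H" using exH[OF B(1)] by blast
        have "i = 1"
        proof (rule ccontr)
          assume "i \<noteq> 1"
          then have i2: "i \<ge> 2" using i(2) B(2) XH by (cases i) auto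
          let ?E = "insert y (E - {x})"
          have E'k: "?E \<in> k_subsets n m"
            using k_subsets_exchange[OF E(1,2), of y] xy(3) y(1) E(3) by blast
          \<comment> \<open>A block \<open>B i\<close> in \<open>H\<close> with
            \<open>i \<ge> 2\<close> would survive this exchange next to \<open>?X\<close>, giving
            two blocks in \<open>H\<close>.\<close>
          let ?B = "B(0 := ?X, 1 := ?E)"
          have Bk: "B l \<in> k_subsets n m" if "l < d" for l
            using B(1) that by (auto simp: block_partitions_def)
          have disj: "B l \<inter> B j = {}" if "l < d" "j < d" "l \<noteq> j" for l j
            using B(1) that by (auto simp: block_partitions_def)
          have XE: "?X \<inter> ?E = {}" using E(3) x(3) y(1) xy(1) by auto
          have rest: "?X \<inter> B l = {}" "?E \<inter> B l = {}" if "l < d" "l \<noteq> 0" "l \<noteq> 1" for l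
            using disj[of 0 l] disj[of 1 l] that B(2,3) E(2) y(1) \<open>d \<ge> 3\<close> by auto
          have "?B l \<inter> ?B j = {}" if "l < d" "j < d" "l \<noteq> j" for l j
            using that XE rest[of l] rest[of j] disj[of l j]
            by (cases "l = 0"; cases "l = 1"; cases "j = 0"; cases "j = 1") (simp_all add: Int_commute)
          moreover have "?B \<in> {..<d} \<rightarrow>\<^sub>E k_subsets n m"
            using B(1) X'k E'k \<open>d \<ge> 3\<close> by (auto simp: block_partitions_def PiE_iff extensional_def)
          ultimately have "?B \<in> block_partitions n d m" by (simp add: block_partitions_def)
          moreover have "?B 0 \<in> H" "?B i \<in> H" using X'H i i2 by auto
          ultimately have "0 = i" using unique[of ?B 0 i] i \<open>d \<ge> 3\<close> by simp
          then show False using i2 by simp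
        qed
        then show ?thesis using i B by simp
      qed
      \<comment> \<open>Two members of \<open>H\<close> meeting only in \<open>x\<close>; shifting one of them makes them disjoint.\<close>
      let ?R = "{1..n} - X - {x}"
      have "card ?R = n - m - 1"
        using X x(3) xy(4) by (simp add: card_Diff_subset)
      then have "m - 1 \<le> card ?R" using n3 by simp
      then obtain E1 where E1: "E1 \<subseteq> ?R" "card E1 = m - 1" "finite E1"
        by (rule obtain_subset_with_card_n)
      have "card (?R - E1) = n - m - 1 - (m - 1)"
        using E1 \<open>card ?R = n - m - 1\<close> by (simp add: card_Diff_subset)
      then have "m - 1 \<le> card (?R - E1)" using n3 \<open>m \<ge> 1\<close> by simp
      then obtain E2 where E2: "E2 \<subseteq> ?R - E1" "card E2 = m - 1" "finite E2"
        by (rule obtain_subset_with_card_n)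
      have xE: "x \<notin> E1" "x \<notin> E2" using E1 E2 by auto
      have k: "insert x E1 \<in> k_subsets n m" "insert x E2 \<in> k_subsets n m"
        using E1 E2 xE xy(4) \<open>m \<ge> 1\<close> by (auto simp: k_subsets_def)
      have EH: "insert x E1 \<in> H" "insert x E2 \<in> H"
        using E k E1(1) E2(1) x(3) by blast+
      have "1 \<notin> E1" using E1(1) less.prems(2) by auto
      then have "insert 1 (insert x E1 - {x}) \<in> H"
        using shiftedD[OF sh EH(1), of 1 x] xy by auto
      then have "insert 1 E1 \<in> H" using xE by simp
      moreover have "insert 1 E1 \<inter> insert x E2 = {}"
        using xE E2(1) less.prems(2) xy(2) by auto
      ultimately show False using inter EH(2) by blast
    qed
  qed
qed

section \<open>Intersecting families\<close>

text \<open>Complementation turns the lower bound on \<open>F\<close> into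
  \<open>card H \<le> (n - 1) choose (m - 1)\<close>, which is the fraction \<open>1/d\<close> of
  all \<open>m\<close>-sets that the averaging requires.\<close>

lemma d_wise_star_exact:
  assumes n: "n = d * m" "k + m = n" and "m \<ge> 1" "d \<ge> 3"
    and F: "F \<subseteq> k_subsets n k" and sh: "shifted n F" and dw: "d_wise_intersecting d F"
    and card: "(n - 1) choose (k - 1) \<le> card F" and A: "A \<in> F"
  shows "1 \<in> A"
proof (rule ccontr)
  assume A1: "1 \<notin> A"
  have n3: "3 * m \<le> n" using \<open>d \<ge> 3\<close> n by simp
  define H where "H = {X \<in> k_subsets n m. {1..n} - X \<notin> F}"
  have compl: "{1..n} - X \<in> k_subsets n (n - j)" if "X \<in> k_subsets n j" for X j
    using k_subsetsD[OF that] by (auto simp: k_subsets_def card_Diff_subset)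
  have dc: "{1..n} - ({1..n} - X) = X" if "X \<in> k_subsets n j" for X j
    using k_subsetsD(1)[OF that] by auto
  have mn: "n - k = m" "n - m = k" using n(2) by auto
  have Hsub: "H \<subseteq> k_subsets n m" by (auto simp: H_def)
  have "k_subsets n m - H = (\<lambda>X. {1..n} - X) ` F"
  proof
    show "k_subsets n m - H \<subseteq> (\<lambda>X. {1..n} - X) ` F"
    proof
      fix X assume "X \<in> k_subsets n m - H"
      then have "{1..n} - X \<in> F" "X = {1..n} - ({1..n} - X)"
        using dc[of X m] by (auto simp: H_def)
      then show "X \<in> (\<lambda>X. {1..n} - X) ` F" by blast
    qed
    show "(\<lambda>X. {1..n} - X) ` F \<subseteq> k_subsets n m - H"
      using F compl[of _ k] dc[of _ k] mn by (auto simp: H_def)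
  qed
  moreover have "inj_on (\<lambda>X. {1..n} - X) F"
    using F dc[of _ k] by (metis inj_onI subsetD)
  ultimately have "card (k_subsets n m - H) = card F" by (simp add: card_image)
  then have "(n choose m) = card H + card F"
    using Hsub card_Diff_subset[of H "k_subsets n m"] card_mono[OF finite_k_subsets Hsub] 
      finite_subset[OF Hsub] by (simp add: card_k_subsets)
  moreover have "n choose m = (n - 1 choose (m - 1)) + (n - 1 choose m)"
    using n3 \<open>m \<ge> 1\<close> choose_reduce_nat[of n m] by simp
  moreover have "(n - 1 choose m) = (n - 1 choose (k - 1))"
  proof -
    have "n - 1 - m = k - 1" "m \<le> n - 1" using n(2) n3 \<open>m \<ge> 1\<close> by linarith+
    then show ?thesis using binomial_symmetric[of m "n - 1"] by simp
  qed
  ultimately have "card H \<le> (n - 1) choose (m - 1)" using card by simp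
  moreover have "m * (n choose m) = n * ((n - 1) choose (m - 1))"
    using times_binomial_minus1_eq[of m n] \<open>m \<ge> 1\<close> by simp
  then have "d * ((n - 1) choose (m - 1)) = n choose m" using n \<open>m \<ge> 1\<close> by simp
  ultimately have dH: "d * card H \<le> n choose m" by (metis mult_le_mono2)
  \<comment> \<open>The complements of the blocks of a partition have no common point, so they
    cannot all belong to \<open>F\<close>.\<close>
  have ex: "\<exists>i<d. B i \<in> H" if B: "B \<in> block_partitions n d m" for B
  proof (rule ccontr)
    assume "\<not> ?thesis"
    then have none: "\<And>i. i < d \<Longrightarrow> B i \<notin> H" by blast
    have Bk: "B i \<in> k_subsets n m" if "i < d" for i
      using B that by (auto simp: block_partitions_def)
    have "card (\<Union>i<d. B i) = (\<Sum>i<d. card (B i))"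
      using B Bk k_subsetsD(3) by (intro card_UN_disjoint) (auto simp: block_partitions_def)
    also have "\<dots> = (\<Sum>i<d. m)" by (rule sum.cong) (use Bk k_subsetsD(2) in auto)
    also have "\<dots> = n" using n(1) by simp
    finally have "card (\<Union>i<d. B i) = n" .
    moreover have "(\<Union>i<d. B i) \<subseteq> {1..n}" using Bk k_subsetsD(1) by blast
    ultimately have U: "(\<Union>i<d. B i) = {1..n}" by (intro card_subset_eq) auto
    let ?S = "(\<lambda>i. {1..n} - B i) ` {..<d}"
    have "?S \<subseteq> F" using none Bk by (auto simp: H_def)
    moreover have "finite ?S" "?S \<noteq> {}" using \<open>d \<ge> 3\<close> by (auto simp: lessThan_empty_iff)
    moreover have "card ?S \<le> d" using card_image_le[of "{..<d}"] by simp
    ultimately have "\<Inter>?S \<noteq> {}" using dw unfolding d_wise_intersecting_def by blast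
    then obtain z where z: "\<And>i. i < d \<Longrightarrow> z \<in> {1..n} - B i" by blast
    have "z \<in> {1..n}" using z[of 0] \<open>d \<ge> 3\<close> by simp
    then show False using U z by blast
  qed
  have shH: "shifted n H"
    unfolding shifted_def
  proof (intro ballI allI impI)
    fix X i j assume X: "X \<in> H" and ij: "1 \<le> i \<and> i < j \<and> j \<le> n \<and> j \<in> X \<and> i \<notin> X"
    have Xk: "X \<in> k_subsets n m" using X Hsub by auto
    let ?X = "insert i (X - {j})"
    have "?X \<in> k_subsets n m" using k_subsets_exchange[OF Xk] ij by auto
    moreover have "{1..n} - ?X \<notin> F"
    proof
      assume "{1..n} - ?X \<in> F"
      \<comment> \<open>The complement of \<open>?X\<close> contains \<open>j\<close> but not
        \<open>i\<close>, so shifting it restores the complement of \<open>X\<close>.\<close>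
      then have "insert i ({1..n} - ?X - {j}) \<in> F"
        using ij by (intro shiftedD[OF sh]) auto
      moreover have "insert i ({1..n} - ?X - {j}) = {1..n} - X" using ij by auto
      ultimately show False using X by (simp add: H_def)
    qed
    ultimately show "?X \<in> H" by (simp add: H_def)
  qed
  have Ak: "A \<in> k_subsets n k" using A F by auto
  have "{1..n} - A \<in> H"
  proof (rule exactly_one_block_imp_star[OF Hsub shH n(1) \<open>m \<ge> 1\<close> \<open>d \<ge> 3\<close>])
    show "card {i. i < d \<and> B i \<in> H} = 1" if "B \<in> block_partitions n d m" for B
      using block_partitions_exactly_one[OF Hsub dH _ ex that] n3 by simp
    show "{1..n} - A \<in> k_subsets n m" using compl[OF Ak] mn by simp
    show "1 \<in> {1..n} - A" using A1 n3 \<open>m \<ge> 1\<close> by simp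
  qed
  then show False using dc[OF Ak] A by (simp add: H_def)
qed

text \<open>Induct on the defect \<open>r = d * m - n\<close>. The upper shadow raises
  \<open>n\<close> and \<open>k\<close> by one and keeps \<open>m\<close>, so the defect drops by
  one.\<close>

lemma d_wise_star:
  assumes "d * m = n + r" "k + m = n" "m \<ge> 1" "k \<ge> 1" "d \<ge> 3"
    and "F \<subseteq> k_subsets n k" "shifted n F" "d_wise_intersecting d F"
    and "(n - 1) choose (k - 1) \<le> card F" "A \<in> F"
  shows "1 \<in> A"
  using assms
proof (induction r arbitrary: n k F A)
  case 0
  then show ?case using d_wise_star_exact[of n d m k F A] by simp
next
  case (Suc r)
  let ?F = "upper_shadow (Suc n) F"
  have n1: "Suc (n - 1) = n" "Suc (k - 1) = k" using Suc.prems by auto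
  have "n - 1 choose k \<le> card (upper_shadow n F)"
    using card_upper_shadow_shifted[of "n - 1" F "k - 1"] Suc.prems n1 by simp
  then have "(n - 1 choose k) + (n - 1 choose (k - 1)) \<le> card (upper_shadow n F) + card F"
    using Suc.prems by linarith
  also have "\<dots> \<le> card ?F" by (rule card_upper_shadow_ge) (rule Suc.prems)
  also have "(n - 1 choose k) + (n - 1 choose (k - 1)) = n choose k"
    using choose_reduce_nat[of n k] Suc.prems by simp
  finally have c: "n choose k \<le> card ?F" .
  have An: "Suc n \<notin> A" using Suc.prems k_subsetsD(1)[of A n k] by fastforce
  then have "insert (Suc n) A \<in> ?F" using Suc.prems unfolding upper_shadow_def by fastforce
  then have "1 \<in> insert (Suc n) A"
    using Suc.prems c
    by (intro Suc.IH[of "Suc n" "Suc k" ?F] upper_shadow_k_subsets shifted_upper_shadow d_wise_upper_shadow) auto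
  then show ?case using Suc.prems by auto
qed

section \<open>The intersection condition for small unions\<close>

lemma cond_intersecting_deletion: "cond_intersecting d k F \<Longrightarrow> cond_intersecting d k (deletion x F)"
  unfolding cond_intersecting_def deletion_def by blast

lemma cond_intersecting_link:
  assumes F: "F \<subseteq> k_subsets (Suc n) (Suc k)" and sh: "shifted (Suc n) F"
    and ci: "cond_intersecting d (Suc k) F" and "d \<ge> 2" and nd: "d * Suc k + Suc n \<le> d * Suc n"
  shows "cond_intersecting d k (link (Suc n) F)"
  unfolding cond_intersecting_def
proof (intro allI impI notI)
  fix S assume S: "S \<subseteq> link (Suc n) F" "card S = d \<and> card (\<Union>S) + d \<le> 2 * k + 2" "\<Inter>S = {}"
  have finS: "finite S" using S(2) \<open>d \<ge> 2\<close> card.infinite by fastforce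
  have Sk: "A \<in> k_subsets n k" if "A \<in> S" for A
    using that S(1) link_k_subsets[OF F] by blast
  \<comment> \<open>Some \<open>x\<close> is missed by two members of \<open>S\<close>: by
    \<open>nd\<close>, \<open>d * (n - k) > n\<close>, so the \<open>d\<close> complements cannot be
    pairwise disjoint.\<close>
  have ex: "\<exists>A\<in>S. \<exists>x\<in>{1..n}. x \<notin> A \<and> x \<notin> \<Inter>(S - {A})"
  proof (rule ccontr)
    assume "\<not> ?thesis"
    then have cov: "x \<in> B" if "A \<in> S" "B \<in> S" "A \<noteq> B" "x \<in> {1..n}" "x \<notin> A" for A B x
      using that by blast
    have "card (\<Union>A\<in>S. {1..n} - A) = (\<Sum>A\<in>S. card ({1..n} - A))"
      by (rule card_UN_disjoint[OF finS]) (simp, use cov in blast)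
    also have "\<dots> = (\<Sum>A\<in>S. n - k)"
      by (rule sum.cong) (use k_subsetsD[OF Sk] in \<open>simp_all add: card_Diff_subset\<close>)
    also have "\<dots> = d * (n - k)" using S(2) by simp
    finally have "d * (n - k) \<le> n"
      using card_mono[of "{1..n}" "\<Union>A\<in>S. {1..n} - A"] by auto
    then show False using nd by (simp add: right_diff_distrib')
  qed
  then obtain A x where A: "A \<in> S" and x: "x \<in> {1..n}" "x \<notin> A" "x \<notin> \<Inter>(S - {A})" by blast
  have notin: "Suc n \<notin> B" if "B \<in> S" for B using that S(1) by (auto simp: link_def)
  let ?T = "insert (Suc n) ` (S - {A})"
  let ?S = "insert (insert x A) ?T"
  have "insert x (insert (Suc n) A - {Suc n}) \<in> F"
    using A S(1) x by (intro shiftedD[OF sh]) (auto simp: link_def)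
  then have "insert x A \<in> F" using notin[OF A] by simp
  then have "?S \<subseteq> F" using S(1) by (auto simp: link_def)
  moreover have "card ?S = d"
  proof -
    have "inj_on (insert (Suc n)) (S - {A})" 
      using notin unfolding inj_on_def by (metis DiffD1 insert_ident)
    then have "card ?T = d - 1" using S(2) A finS by (simp add: card_image)
    moreover have "Suc n \<notin> insert x A" using notin[OF A] x(1) by auto
    then have "insert x A \<notin> ?T" by blast
    ultimately show ?thesis using finS \<open>d \<ge> 2\<close> by simp
  qed
  \<comment> \<open>Only \<open>x\<close> and \<open>Suc n\<close> can be new in the union, and the
    bound also grows by two.\<close>
  moreover have "card (\<Union>?S) + d \<le> 2 * Suc k + 2"
  proof -
    have fin: "finite (\<Union>S)" using finS k_subsetsD(3)[OF Sk] by (rule finite_Union)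
    have "\<Union>?S \<subseteq> insert (Suc n) (insert x (\<Union>S))" using A by auto
    then have "card (\<Union>?S) \<le> card (insert (Suc n) (insert x (\<Union>S)))"
      using fin by (intro card_mono) auto
    also have "\<dots> \<le> Suc (Suc (card (\<Union>S)))"
      using fin by (simp add: card_insert_if)
    finally show ?thesis using S(2) by simp
  qed
  ultimately have "\<Inter>?S \<noteq> {}" using ci unfolding cond_intersecting_def by blast
  then obtain y where y: "y \<in> insert x A" "\<And>B. B \<in> S \<Longrightarrow> B \<noteq> A \<Longrightarrow> y \<in> insert (Suc n) B"
    by auto
  have "y \<noteq> Suc n" using y(1) notin[OF A] x(1) by auto
  then have yB: "y \<in> B" if "B \<in> S" "B \<noteq> A" for B using y(2) that by auto
  then have "y \<noteq> x" using x(3) by auto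
  then have "y \<in> \<Inter>S" using y(1) yB by auto
  then show False using S(3) by simp
qed

text \<open>The \<open>k + 1\<close> subsets of size \<open>k\<close> of \<open>{1..Suc k}\<close>
  have empty intersection and a union just small enough for the condition.\<close>

lemma cond_intersecting_simplex:
  assumes F: "F \<subseteq> k_subsets n k" and sh: "shifted n F" and ci: "cond_intersecting (Suc k) k F"
    and "k < n" "A \<in> F"
  shows "1 \<in> A"
proof (rule ccontr)
  assume A1: "1 \<notin> A"
  note Ak = k_subsetsD[OF subsetD[OF F \<open>A \<in> F\<close>]]
  have "{1..Suc k} - {i} \<in> F" if i: "i \<in> {1..Suc k}" for i
  proof (rule shifted_compress[OF sh F \<open>A \<in> F\<close>])
    show "{1..Suc k} - {i} \<in> k_subsets n k"
      using i \<open>k < n\<close> by (auto simp: k_subsets_def)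
    fix j
    have "card (A \<inter> {1..j}) \<le> k" using Ak card_mono[of A "A \<inter> {1..j}"] by simp
    moreover have "x \<noteq> 1" if "x \<in> A" for x using A1 that by blast
    then have "A \<inter> {1..j} \<subseteq> {2..j}" by (fastforce simp: le_less)
    then have "card (A \<inter> {1..j}) \<le> j - 1" using card_mono[of "{2..j}"] by fastforce
    ultimately have "card (A \<inter> {1..j}) \<le> min (Suc k) j - 1" by simp
    also have "\<dots> \<le> card ({1..min (Suc k) j} - {i})" 
      using diff_card_le_card_Diff[of "{i}" "{1..min (Suc k) j}"] by simp
    also have "{1..min (Suc k) j} - {i} = ({1..Suc k} - {i}) \<inter> {1..j}" by auto
    finally show "card (A \<inter> {1..j}) \<le> card (({1..Suc k} - {i}) \<inter> {1..j})" .
  qed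
  then have S: "(\<lambda>i. {1..Suc k} - {i}) ` {1..Suc k} \<subseteq> F" (is "?S \<subseteq> F") by blast
  have "inj_on (\<lambda>i. {1..Suc k} - {i}) {1..Suc k}" by (auto simp: inj_on_def)
  then have "card ?S = Suc k" by (simp add: card_image)
  moreover have "card (\<Union>?S) \<le> card {1..Suc k}" by (rule card_mono) auto
  then have "card (\<Union>?S) + Suc k \<le> 2 * k + 2" by simp
  ultimately have "\<Inter>?S \<noteq> {}" using ci S unfolding cond_intersecting_def by blast
  then obtain z where z: "\<And>i. i \<in> {1..Suc k} \<Longrightarrow> z \<in> {1..Suc k} - {i}" by blast
  then have "z \<in> {1..Suc k}" by fastforce
  then show False using z by blast
qed

text \<open>Pad \<open>S\<close> with further members of \<open>F\<close> to exactly
  \<open>d\<close> sets; every union fits into \<open>{1..n}\<close>, hence below the bound.\<close>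

lemma cond_intersecting_imp_d_wise:
  assumes F: "F \<subseteq> k_subsets n k" and ci: "cond_intersecting d k F"
    and "n + d \<le> 2 * k + 2" "d \<le> card F"
  shows "d_wise_intersecting d F"
  unfolding d_wise_intersecting_def
proof (intro allI impI)
  fix S assume S: "S \<subseteq> F" "finite S \<and> S \<noteq> {} \<and> card S \<le> d"
  have finF: "finite F" using F by (rule finite_subset) simp
  have "card (F - S) = card F - card S" using S finF by (simp add: card_Diff_subset)
  then have "d - card S \<le> card (F - S)" using \<open>d \<le> card F\<close> by simp
  then obtain R where R: "R \<subseteq> F - S" "card R = d - card S" "finite R" 
    by (rule obtain_subset_with_card_n)
  have "card (S \<union> R) = d" using S R by (subst card_Un_disjoint) auto
  moreover have "S \<union> R \<subseteq> F" using S R by auto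
  moreover have "\<Union>(S \<union> R) \<subseteq> {1..n}" using \<open>S \<union> R \<subseteq> F\<close> F k_subsetsD(1) by blast
  then have "card (\<Union>(S \<union> R)) \<le> n" using card_mono[of "{1..n}"] by fastforce
  ultimately have "\<Inter>(S \<union> R) \<noteq> {}" using ci assms(3) unfolding cond_intersecting_def by simp
  then show "\<Inter>S \<noteq> {}" by auto
qed

text \<open>Allowing \<open>d = Suc k\<close> lets the induction reach the link, whose sets are
  smaller by one.\<close>

lemma cond_intersecting_star:
  assumes "d \<ge> 3" "d \<le> Suc k" "d * k + n \<le> d * n" "n \<ge> 1"
    and "F \<subseteq> k_subsets n k" "shifted n F" "cond_intersecting d k F"
    and "(n - 1) choose (k - 1) \<le> card F" "A \<in> F"
  shows "1 \<in> A"
  using assms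
proof (induction n arbitrary: k F A)
  case 0
  then show ?case by simp
next
  case (Suc n)
  note F = Suc.prems(5) and sh = Suc.prems(6) and ci = Suc.prems(7) and AF = Suc.prems(9)
  have finF: "finite F" using F by (rule finite_subset) simp
  have "d * k < d * Suc n" using Suc.prems(3) by simp
  then have kn: "k \<le> n" by (simp only: mult_less_cancel1 less_Suc_eq_le)
  have k2: "k \<ge> 2" using Suc.prems by simp
  consider "d = Suc k" | "d \<le> k" "d * k + n \<le> d * n" | "d \<le> k" "d * n < d * k + n"
    using Suc.prems(2) by linarith
  then show ?case
  proof cases
    case 1
    then show ?thesis using cond_intersecting_simplex[OF F sh _ _ AF] ci kn by simp
  next
    case 2
    obtain l where l: "k = Suc l" using k2 by (cases k) auto
    let ?D = "deletion (Suc n) F" and ?L = "link (Suc n) F"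
    have card: "card F = card ?L + card ?D" by (rule card_link_deletion[OF finF])
    have pascal: "n choose l = (n - 1 choose (l - 1)) + (n - 1 choose l)"
      using choose_reduce_nat[of n l] kn k2 l by simp
    have D: "1 \<in> B" if "n - 1 choose l \<le> card ?D" "B \<in> ?D" for B
      using that 2 Suc.prems kn k2 l
      by (intro Suc.IH[of k ?D B] deletion_k_subsets shifted_deletion cond_intersecting_deletion) auto
    have L: "1 \<in> B" if "n - 1 choose (l - 1) \<le> card ?L" "B \<in> ?L" for B
    proof (rule Suc.IH[of l ?L B])
      show "cond_intersecting d l ?L"
        using cond_intersecting_link[of F n l d] Suc.prems l by simp
      show "?L \<subseteq> k_subsets n l" using F l by (simp add: link_k_subsets)
      show "shifted n ?L" by (rule shifted_link[OF sh])
    qed (use that 2 Suc.prems(1-4) kn k2 l in auto)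
    \<comment> \<open>The implication yields the upper bound too: a family larger than a star would
      be contained in one. By Pascal's rule, link and deletion then both attain their
      bounds.\<close>
    have star_le: "card G \<le> (n - 1 choose (j - 1))"
      if "G \<subseteq> k_subsets n j" "j \<ge> 1" "n - 1 choose (j - 1) \<le> card G \<Longrightarrow> \<forall>B\<in>G. 1 \<in> B" for G j
    proof (rule ccontr)
      assume big: "\<not> card G \<le> (n - 1 choose (j - 1))"
      then have "G \<subseteq> {B \<in> k_subsets n j. 1 \<in> B}" using that by auto
      then have "card G \<le> card {B \<in> k_subsets n j. 1 \<in> B}" by (intro card_mono) auto
      also have "\<dots> = (n - 1 choose (j - 1))" by (rule card_star) (use that kn k2 in auto)
      finally show False using big by simp
    qed
    have "card ?D \<le> (n - 1 choose l)"
      using star_le[of ?D k] deletion_k_subsets[OF F] D l by auto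
    moreover have "card ?L \<le> (n - 1 choose (l - 1))"
      using star_le[of ?L l] link_k_subsets[of F n l] F L l k2 by auto
    moreover have "(n choose l) \<le> card F" using Suc.prems l by simp
    ultimately have tight: "n - 1 choose l \<le> card ?D" "n - 1 choose (l - 1) \<le> card ?L"
      using card pascal by linarith+
    show ?thesis
    proof (cases "Suc n \<in> A")
      case True
      then have "A - {Suc n} \<in> ?L" using AF by (simp add: link_def insert_absorb)
      then show ?thesis using L tight by blast
    next
      case False
      then show ?thesis using D tight AF by (simp add: deletion_def)
    qed
  next
    case 3
    obtain m where m: "Suc n = k + m" "m \<ge> 1" using kn that[of "Suc n - k"] by simp
    obtain c where c: "d = c + 2" "c \<ge> 1" using Suc.prems(1) that[of "d - 2"] by simp
    \<comment> \<open>If this failed, minimality of \<open>n\<close>, that is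
      \<open>(d - 1) * n < d * k\<close>, would force \<open>k < d - 1\<close>.\<close>
    have small: "Suc n + d \<le> 2 * k + 2"
    proof (rule ccontr)
      assume "\<not> ?thesis"
      then have "2 * k \<le> n + c" using c by simp
      then have "Suc c * (2 * k) \<le> Suc c * (n + c)" by (rule mult_le_mono2)
      moreover have "Suc c * n < (c + 2) * k" using 3 c by simp
      ultimately have "Suc c * (2 * k) < (c + 2) * k + Suc c * c" by (simp add: algebra_simps)
      then have "c * k < Suc c * c" by (simp add: algebra_simps)
      moreover have "c * (c + 2) \<le> c * k" using 3(1) c by (intro mult_le_mono2) simp
      ultimately show False by (simp add: algebra_simps)
    qed
    \<comment> \<open>\<open>F\<close> has at least \<open>d\<close> members, as the padding to
      \<open>d\<close> distinct sets requires.\<close>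
    have "d \<le> k" by (rule 3)
    also have "k = (k choose (k - 1))" using k2 binomial_symmetric[of 1 k] by simp
    also have "\<dots> \<le> (n choose (k - 1))" using kn by (rule binomial_right_mono)
    also have "\<dots> \<le> card F" using Suc.prems by simp
    finally have dw: "d_wise_intersecting d F"
      using cond_intersecting_imp_d_wise[OF F ci small] by simp
    have "Suc n \<le> d * m" using Suc.prems(3) m by (simp add: algebra_simps)
    then obtain r where r: "d * m = Suc n + r" using le_Suc_ex by blast
    have "k \<ge> 1" using k2 by simp
    from r m(1)[symmetric] m(2) this Suc.prems(1) F sh dw Suc.prems(8) AF show ?thesis
      by (rule d_wise_star)
  qed
qed

theorem theorem5:
  fixes n k d :: nat and F :: "nat set set"
  assumes "d \<ge> 3" and "k \<ge> d"
    and "real n \<ge> real d * real k / (real d - 1)"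
    and "F \<subseteq> k_subsets n k"
    and "stable_family n F"
    and "\<And>A :: nat \<Rightarrow> nat set.
           (\<forall>i\<in>{1..d}. A i \<in> F) \<Longrightarrow> inj_on A {1..d} \<Longrightarrow>
           int (card (\<Union>i\<in>{1..d}. A i)) \<le> 2 * int k - (int d - 2) \<Longrightarrow>
           (\<Inter>i\<in>{1..d}. A i) \<noteq> {}"
  shows "card F \<le> (n - 1) choose (k - 1) \<and>
         (card F = (n - 1) choose (k - 1) \<longleftrightarrow> is_star n k F)"
proof -
  have "real d * real k \<le> real n * (real d - 1)"
    using assms(1,3) by (simp add: pos_divide_le_eq)
  then have "real (d * k + n) \<le> real (d * n)" by (simp add: algebra_simps)
  then have dn: "d * k + n \<le> d * n" by (simp only: of_nat_le_iff)
  have n1: "n \<ge> 1" using dn assms(1,2) by (cases n) auto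
  have ci: "cond_intersecting d k F"
    unfolding cond_intersecting_def
  proof (intro allI impI)
    fix S assume S: "S \<subseteq> F" "card S = d \<and> card (\<Union>S) + d \<le> 2 * k + 2"
    have "finite S" using S assms(1) card.infinite by fastforce
    then obtain A where A: "bij_betw A {1..d} S"
      using finite_same_card_bij[of "{1..d}" S] S(2) by auto
    then have im: "A ` {1..d} = S" by (simp add: bij_betw_def)
    have "(\<Inter>i\<in>{1..d}. A i) \<noteq> {}"
    proof (rule assms(6))
      show "\<forall>i\<in>{1..d}. A i \<in> F" using im S(1) by blast
      show "inj_on A {1..d}" using A by (simp add: bij_betw_def)
      show "int (card (\<Union>i\<in>{1..d}. A i)) \<le> 2 * int k - (int d - 2)"
        using S(2) im by simp
    qed
    then show "\<Inter>S \<noteq> {}" using im by simp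
  qed
  let ?star = "\<lambda>x. {A \<in> k_subsets n k. x \<in> A}"
  have k1: "k \<ge> 1" using assms(1,2) by simp
  have card1: "card (?star 1) = (n - 1) choose (k - 1)"
    using card_star[of 1 n k] n1 k1 by simp
  \<comment> \<open>All members contain \<open>1\<close>, and the size leaves no room for a proper
    subfamily of the star.\<close>
  have star: "F = ?star 1" if le: "(n - 1) choose (k - 1) \<le> card F"
  proof -
    have "F \<subseteq> ?star 1"
      using cond_intersecting_star[OF assms(1) _ dn n1 assms(4) stable_imp_shifted[OF assms(5)] ci le]
        assms(2,4) by auto
    moreover have "card (?star 1) \<le> card F" using card1 le by simp
    ultimately show ?thesis by (intro card_seteq) auto
  qed
  show ?thesis
  proof (intro conjI iffI)
    show "card F \<le> (n - 1) choose (k - 1)"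
      using star card1 by (metis nat_le_linear order_refl)
    show "is_star n k F" if "card F = (n - 1) choose (k - 1)"
    proof -
      have "F = ?star 1" using star that by simp
      then show ?thesis unfolding is_star_def using n1 by (intro bexI[of _ 1]) auto
    qed
    show "card F = (n - 1) choose (k - 1)" if "is_star n k F"
      using that card_star k1 unfolding is_star_def by auto
  qed
qed

end
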